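(* For every integer $n\ge1$, $$f_2(4,n)\leq\begin{cases} n+3 & \text{if } n\equiv 1 \pmod 8,\\ n+4 & \text{if } n\equiv 0 \pmod 8,\\ n+5 & \text{if } n\equiv 2,6,7 \pmod 8,\\ n+6 & \text{if } n\equiv 3,4,5 \pmod 8,\end{cases}$$ and equality holds at least for all $n\leq 10$.
   Context: Graphs are finite and simple with nonempty vertex set. A clique of a graph is a set of pairwise adjacent vertices (sets with at most one vertex are cliques); a clique is maximal if it is maximal with respect to inclusion, and $c(G)$ is the number of maximal cliques of $G$. For integers $t\geq2$ and $n\geq1$, $f_2(t,n)$ is the minimum of $\sum_{i=1}^t c(G_i)$ over all factorizations of the complete graph $K_n$ into $t$ edge-disjoint spanning subgraphs $G_1,\dots,G_t$ (all on the same $n$ vertices, some possibly edgeless, whose edge sets partition the edge set of $K_n$). *)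

theory Defs
  imports "HOL-Library.Ramsey" "HOL-Library.Disjoint_Sets"
begin

text \<open>
  A graph is given by its vertex set \<open>V\<close> and its edge set \<open>E\<close>, a set of two-element subsets
  of \<open>V\<close>. The predicate \<^const>\<open>clique\<close> does not refer to \<open>V\<close>, so the restriction of cliques to
  subsets of \<open>V\<close> is explicit; in particular an isolated vertex is a maximal clique.
\<close>

definition maximal_cliques :: "'a set \<Rightarrow> 'a set set \<Rightarrow> 'a set set" where
  "maximal_cliques V E =
     {S. S \<subseteq> V \<and> clique S E \<and> (\<forall>T. T \<subseteq> V \<and> clique T E \<and> S \<subseteq> T \<longrightarrow> T = S)}"

definition num_maximal_cliques :: "'a set \<Rightarrow> 'a set set \<Rightarrow> nat" where
  "num_maximal_cliques V E = card (maximal_cliques V E)"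

text \<open>
  The vertex set of \<open>K\<^sub>n\<close> is \<open>{..<n}\<close>. A factorization is a family of edge sets indexed by
  \<open>i < t\<close>, every factor having the whole of \<open>{..<n}\<close> as its vertex set. Empty members are
  permitted by \<^const>\<open>disjoint_family_on\<close>, so factors may be edgeless.
\<close>

definition complete_graph_factorization :: "nat \<Rightarrow> nat \<Rightarrow> (nat \<Rightarrow> nat set set) \<Rightarrow> bool" where
  "complete_graph_factorization t n G \<longleftrightarrow>
     disjoint_family_on G {..<t} \<and> (\<Union>i<t. G i) = nsets {..<n} 2"

definition f2 :: "nat \<Rightarrow> nat \<Rightarrow> nat" where
  "f2 t n = (LEAST k. \<exists>G. complete_graph_factorization t n G \<and>
                          k = (\<Sum>i<t. num_maximal_cliques {..<n} (G i)))"

lemma complete_graph_factorization_exists: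
  assumes "t \<ge> 1"
  shows "\<exists>G. complete_graph_factorization t n G"
proof -
  have "complete_graph_factorization t n (\<lambda>i. if i = 0 then nsets {..<n} 2 else {})"
    using assms unfolding complete_graph_factorization_def disjoint_family_on_def
    by (auto split: if_splits)
  then show ?thesis by blast
qed

lemma f2_attained:
  assumes "t \<ge> 1"
  shows "\<exists>G. complete_graph_factorization t n G \<and>
             f2 t n = (\<Sum>i<t. num_maximal_cliques {..<n} (G i))"
proof -
  obtain G where "complete_graph_factorization t n G"
    using complete_graph_factorization_exists[OF assms] by blast
  then have "\<exists>k. \<exists>G. complete_graph_factorization t n G \<and>
                  k = (\<Sum>i<t. num_maximal_cliques {..<n} (G i))" by blast
  then show ?thesis unfolding f2_def by (rule LeastI_ex)
qed

lemma f2_le: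
  assumes "complete_graph_factorization t n G"
  shows "f2 t n \<le> (\<Sum>i<t. num_maximal_cliques {..<n} (G i))"
  unfolding f2_def by (rule Least_le) (use assms in blast)

end

theory Submission
  imports Defs
begin

text \<open>
  Upper bound. The nine points of the affine plane over the field with three elements are the
  vertices of a \<open>K\<^sub>9\<close> which is factored according to the four directions: each factor consists of
  three disjoint triangles, the parallel lines, which gives \<open>12\<close> maximal cliques in all. Now
  substitute a factorized \<open>K\<^sub>n\<close> for one point. In each factor only one of the three lines is affected,
  and the maximal cliques it becomes correspond to those of the factor of \<open>K\<^sub>n\<close>; so eight more
  vertices cost eight more maximal cliques, and \<open>f2 4 (n + 8) \<le> f2 4 n + 8\<close>. The bound has the same
  periodicity, hence only \<open>n \<le> 8\<close> is left. For these \<open>n\<close>, suitable subsets of the plane suffice: two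
  points, a triangle, a quadrangle, two parallel lines, and the whole plane, together with the
  monotonicity of \<open>f2\<close> in \<open>n\<close>. All of these are instances of \<open>f2_substitute\<close>, in which the plane is
  replaced by any family of \<open>t\<close> partitions such that two points share a class in exactly one of them.

  Lower bound. Choose, in every factor, a maximal clique through each vertex. This partitions the
  vertices into at most \<open>c(G\<^sub>i)\<close> classes, and two vertices of a class are adjacent in \<open>G\<^sub>i\<close>. There are two
  consequences. First, \<open>G\<^sub>i\<close> has at least \<open>n - c(G\<^sub>i)\<close> edges, and since there are only \<open>n choose 2\<close> edges
  to distribute, \<open>t n - (n choose 2) \<le> \<Sum>c(G\<^sub>i)\<close>; this is the bound for \<open>n \<le> 4\<close>. Second, two
  vertices cannot share a class in two different factors, so \<open>n \<le> c(G\<^sub>i) c(G\<^sub>j)\<close> for \<open>i \<noteq> j\<close>; this gives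
  \<open>11\<close>, \<open>12\<close>, \<open>15\<close> for \<open>n = 5, 7, 10\<close>. Monotonicity supplies \<open>n = 6, 8, 9\<close>.
\<close>

section \<open>Maximal cliques\<close>

lemma finite_maximal_cliques: "finite V \<Longrightarrow> finite (maximal_cliques V E)"
  by (rule finite_subset[of _ "Pow V"]) (auto simp: maximal_cliques_def)

lemma maximal_cliquesD:
  assumes "S \<in> maximal_cliques V E"
  shows "S \<subseteq> V" "clique S E" "\<And>T. T \<subseteq> V \<Longrightarrow> clique T E \<Longrightarrow> S \<subseteq> T \<Longrightarrow> T = S"
  using assms by (auto simp: maximal_cliques_def)

lemma clique_extends_to_maximal:
  assumes "finite V" "S \<subseteq> V" "clique S E"
  obtains M where "M \<in> maximal_cliques V E" "S \<subseteq> M"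
proof -
  have fin: "finite {T. T \<subseteq> V \<and> clique T E}"
    by (rule finite_subset[of _ "Pow V"]) (use assms in auto)
  have "S \<in> {T. T \<subseteq> V \<and> clique T E}"
    using assms by auto
  from finite_has_maximal2[OF fin this] obtain M
    where "M \<in> {T. T \<subseteq> V \<and> clique T E}" "S \<subseteq> M"
      "\<forall>T\<in>{T. T \<subseteq> V \<and> clique T E}. M \<subseteq> T \<longrightarrow> M = T"
    by blast
  then show ?thesis
    by (intro that[of M]) (auto simp: maximal_cliques_def)
qed

lemma clique_cong:
  assumes "\<And>u v. u \<in> S \<Longrightarrow> v \<in> S \<Longrightarrow> u \<noteq> v \<Longrightarrow> {u, v} \<in> E \<longleftrightarrow> {u, v} \<in> F"
  shows "clique S E \<longleftrightarrow> clique S F"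
  using assms unfolding clique_def by blast

lemma maximal_cliques_cong:
  assumes "\<And>u v. u \<in> V \<Longrightarrow> v \<in> V \<Longrightarrow> u \<noteq> v \<Longrightarrow> {u, v} \<in> E \<longleftrightarrow> {u, v} \<in> F"
  shows "maximal_cliques V E = maximal_cliques V F"
proof -
  have "clique S E \<longleftrightarrow> clique S F" if "S \<subseteq> V" for S
    using that assms by (intro clique_cong) blast
  then show ?thesis
    unfolding maximal_cliques_def by blast
qed

lemma num_maximal_cliques_clique: "clique V E \<Longrightarrow> num_maximal_cliques V E = 1"
proof -
  assume "clique V E"
  then have "maximal_cliques V E = {V}"
    unfolding maximal_cliques_def by (auto intro: smaller_clique)
  then show ?thesis
    by (simp add: num_maximal_cliques_def)
qed

text \<open>
  A maximal clique of an induced subgraph is the trace of any maximal clique of the whole graph that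
  extends it.
\<close>

lemma num_maximal_cliques_mono:
  assumes "finite W" "V \<subseteq> W"
  shows "num_maximal_cliques V E \<le> num_maximal_cliques W E"
proof -
  have "S \<in> (\<lambda>M. M \<inter> V) ` maximal_cliques W E" if S: "S \<in> maximal_cliques V E" for S
  proof -
    have "S \<subseteq> W" "clique S E"
      using maximal_cliquesD[OF S] assms(2) by auto
    then obtain M where M: "M \<in> maximal_cliques W E" "S \<subseteq> M"
      using clique_extends_to_maximal[OF assms(1)] by blast
    have "clique (M \<inter> V) E"
      using maximal_cliquesD(2)[OF M(1)] by (rule smaller_clique) auto
    moreover have "S \<subseteq> M \<inter> V"
      using M(2) maximal_cliquesD(1)[OF S] by auto
    ultimately have "M \<inter> V = S"
      using maximal_cliquesD(3)[OF S, of "M \<inter> V"] by auto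
    then show ?thesis
      using M(1) by blast
  qed
  then show ?thesis
    unfolding num_maximal_cliques_def
    by (intro surj_card_le[where f = "\<lambda>M. M \<inter> V"] finite_maximal_cliques assms(1)) auto
qed

text \<open>
  A vertex that is adjacent to all others lies in every maximal clique, so a maximal clique is
  determined by its trace on the remaining vertices.
\<close>

lemma num_maximal_cliques_join:
  assumes "finite A" "finite L" "A \<inter> L = {}"
    and adj: "\<And>l x. l \<in> L \<Longrightarrow> x \<in> A \<union> L \<Longrightarrow> l \<noteq> x \<Longrightarrow> {l, x} \<in> E"
  shows "num_maximal_cliques (A \<union> L) E \<le> num_maximal_cliques A E"
proof -
  have add: "clique (T \<union> L) E" if "T \<subseteq> A \<union> L" "clique T E" for T
    unfolding clique_def
  proof (intro ballI impI)
    fix u v assume uv: "u \<in> T \<union> L" "v \<in> T \<union> L" "u \<noteq> v"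
    show "{u, v} \<in> E"
    proof (cases "u \<in> L \<or> v \<in> L")
      case True
      then show ?thesis
        using adj[of u v] adj[of v u] uv that(1) by (auto simp: insert_commute)
    next
      case False
      then show ?thesis
        using uv that(2) by (auto simp: clique_def)
    qed
  qed
  have L: "L \<subseteq> S" if S: "S \<in> maximal_cliques (A \<union> L) E" for S
  proof -
    have "S \<union> L = S"
      using maximal_cliquesD[OF S] add[of S] by (metis Un_least Un_upper1 sup.cobounded2)
    then show ?thesis by auto
  qed
  have trace: "S \<inter> A \<in> maximal_cliques A E" if S: "S \<in> maximal_cliques (A \<union> L) E" for S
  proof -
    have "T = S \<inter> A" if T: "T \<subseteq> A" "clique T E" "S \<inter> A \<subseteq> T" for T
    proof -
      have "S \<subseteq> T \<union> L"
        using T maximal_cliquesD(1)[OF S] by auto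
      then have "T \<union> L = S"
        using maximal_cliquesD(3)[OF S, of "T \<union> L"] add[of T] T by auto
      then show ?thesis
        using T(1) assms(3) by auto
    qed
    moreover have "clique (S \<inter> A) E"
      using maximal_cliquesD(2)[OF S] by (rule smaller_clique) auto
    ultimately show ?thesis
      by (auto simp: maximal_cliques_def)
  qed
  have "inj_on (\<lambda>S. S \<inter> A) (maximal_cliques (A \<union> L) E)"
  proof (rule inj_onI)
    fix S T assume "S \<in> maximal_cliques (A \<union> L) E" "T \<in> maximal_cliques (A \<union> L) E"
      and "S \<inter> A = T \<inter> A"
    then show "S = T"
      using L[of S] L[of T] maximal_cliquesD(1)[of S] maximal_cliquesD(1)[of T] by blast
  qed
  then show ?thesis
    unfolding num_maximal_cliques_def
    by (rule card_inj_on_le) (use trace finite_maximal_cliques assms(1) in auto)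
qed

text \<open>
  If the vertex set is split by a function \<open>f\<close> that is constant along edges, every nonempty clique
  lies in one fibre. Nonemptiness of \<open>V\<close> matters: the empty graph has the empty set as a maximal
  clique, but there are no fibres.
\<close>

lemma num_maximal_cliques_fibres:
  assumes "finite V" "V \<noteq> {}"
    and edge: "\<And>u v. u \<in> V \<Longrightarrow> v \<in> V \<Longrightarrow> u \<noteq> v \<Longrightarrow> {u, v} \<in> E \<Longrightarrow> f u = f v"
  shows "num_maximal_cliques V E \<le> (\<Sum>x\<in>f ` V. num_maximal_cliques {v \<in> V. f v = x} E)"
proof -
  have "S \<in> (\<Union>x\<in>f ` V. maximal_cliques {v \<in> V. f v = x} E)"
    if S: "S \<in> maximal_cliques V E" for S
  proof -
    obtain w where w: "w \<in> V"
      using assms(2) by auto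
    have "S \<noteq> {}"
      using maximal_cliquesD(3)[OF S, of "{w}"] w by (auto simp: clique_def)
    then obtain s where s: "s \<in> S" by auto
    have "S \<subseteq> {v \<in> V. f v = f s}"
    proof
      fix v assume v: "v \<in> S"
      have "v = s \<or> {v, s} \<in> E"
        using maximal_cliquesD(2)[OF S] v s by (auto simp: clique_def)
      then show "v \<in> {v \<in> V. f v = f s}"
        using edge[of v s] v s maximal_cliquesD(1)[OF S] by auto
    qed
    then have "S \<in> maximal_cliques {v \<in> V. f v = f s} E"
      using S by (auto simp: maximal_cliques_def)
    moreover have "s \<in> V"
      using s maximal_cliquesD(1)[OF S] by auto
    ultimately show ?thesis by blast
  qed
  then have "card (maximal_cliques V E) \<le> card (\<Union>x\<in>f ` V. maximal_cliques {v \<in> V. f v = x} E)"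
    by (intro card_mono finite_UN_I finite_imageI finite_maximal_cliques) (use assms(1) in auto)
  also have "\<dots> \<le> (\<Sum>x\<in>f ` V. card (maximal_cliques {v \<in> V. f v = x} E))"
    by (rule card_UN_le) (use assms(1) in auto)
  finally show ?thesis
    by (simp add: num_maximal_cliques_def)
qed

section \<open>Lower bounds\<close>

text \<open>
  Both lower bounds rest on the choice of one maximal clique \<open>c v\<close> through every vertex \<open>v\<close>. The classes
  \<open>c u = c v\<close> partition \<open>V\<close> into at most \<open>num_maximal_cliques V E\<close> cliques.
\<close>

lemma clique_partition:
  assumes "finite V"
  obtains c where "c ` V \<subseteq> maximal_cliques V E"
    and "\<And>u v. u \<in> V \<Longrightarrow> v \<in> V \<Longrightarrow> u \<noteq> v \<Longrightarrow> c u = c v \<Longrightarrow> {u, v} \<in> E"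
proof -
  have "\<exists>M. M \<in> maximal_cliques V E \<and> v \<in> M" if "v \<in> V" for v
    using clique_extends_to_maximal[OF assms, of "{v}" E] that
    by (metis clique_def empty_subsetI insert_subset singletonD)
  then obtain c where c: "\<And>v. v \<in> V \<Longrightarrow> c v \<in> maximal_cliques V E \<and> v \<in> c v"
    by metis
  have "{u, v} \<in> E" if "u \<in> V" "v \<in> V" "u \<noteq> v" "c u = c v" for u v
    using c[OF that(1)] c[OF that(2)] that maximal_cliquesD(2)[of "c v" V E]
    unfolding clique_def by auto
  then show ?thesis
    using c by (intro that[of c]) auto
qed

text \<open>
  Join every vertex to a fixed representative of its class. These edges are distinct, and there is
  one for every vertex that is not a representative.
\<close>

lemma card_le_num_maximal_cliques_plus_edges:
  assumes "finite V"
  shows "card V \<le> num_maximal_cliques V E + card (E \<inter> nsets V 2)"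
proof -
  obtain c where c: "c ` V \<subseteq> maximal_cliques V E"
    and edge: "\<And>u v. u \<in> V \<Longrightarrow> v \<in> V \<Longrightarrow> u \<noteq> v \<Longrightarrow> c u = c v \<Longrightarrow> {u, v} \<in> E"
    using clique_partition[OF assms] by blast
  define r where "r v = inv_into V c (c v)" for v
  have r: "r v \<in> V" "c (r v) = c v" if "v \<in> V" for v
    using that unfolding r_def by (simp_all add: inv_into_into f_inv_into_f)
  have rep: "r ` V = inv_into V c ` c ` V"
    by (auto simp: r_def)
  have "card (r ` V) \<le> card (c ` V)"
    unfolding rep by (rule card_image_le) (use assms in auto)
  also have "\<dots> \<le> num_maximal_cliques V E"
    unfolding num_maximal_cliques_def by (intro card_mono finite_maximal_cliques assms c)
  finally have 1: "card (r ` V) \<le> num_maximal_cliques V E" .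
  have "card (V - r ` V) \<le> card (E \<inter> nsets V 2)"
  proof (rule card_inj_on_le[where f = "\<lambda>v. {v, r v}"])
    show "inj_on (\<lambda>v. {v, r v}) (V - r ` V)"
    proof (rule inj_onI)
      fix u v assume "u \<in> V - r ` V" "v \<in> V - r ` V" "{u, r u} = {v, r v}"
      then show "u = v" by (auto simp: doubleton_eq_iff)
    qed
    show "(\<lambda>v. {v, r v}) ` (V - r ` V) \<subseteq> E \<inter> nsets V 2"
    proof clarify
      fix v assume "v \<in> V" "v \<notin> r ` V"
      moreover from this have "v \<noteq> r v" by auto
      ultimately show "{v, r v} \<in> E \<inter> nsets V 2"
        using r[of v] edge[of v "r v"] by auto
    qed
    show "finite (E \<inter> nsets V 2)"
      using assms by (auto simp: finite_imp_finite_nsets)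
  qed
  moreover have "r ` V \<subseteq> V"
    using r by auto
  then have "card V = card (r ` V) + card (V - r ` V)"
    using assms by (metis card_Diff_subset card_mono finite_subset le_add_diff_inverse)
  ultimately show ?thesis
    using 1 by simp
qed

text \<open>A vertex is determined by its classes in two edge-disjoint graphs.\<close>

lemma card_le_num_maximal_cliques_mult:
  assumes "finite V" "E \<inter> F = {}"
  shows "card V \<le> num_maximal_cliques V E * num_maximal_cliques V F"
proof -
  obtain c where c: "c ` V \<subseteq> maximal_cliques V E"
    and cE: "\<And>u v. u \<in> V \<Longrightarrow> v \<in> V \<Longrightarrow> u \<noteq> v \<Longrightarrow> c u = c v \<Longrightarrow> {u, v} \<in> E"
    using clique_partition[OF assms(1)] by blast
  obtain d where d: "d ` V \<subseteq> maximal_cliques V F"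
    and dF: "\<And>u v. u \<in> V \<Longrightarrow> v \<in> V \<Longrightarrow> u \<noteq> v \<Longrightarrow> d u = d v \<Longrightarrow> {u, v} \<in> F"
    using clique_partition[OF assms(1)] by blast
  have "card V \<le> card (maximal_cliques V E \<times> maximal_cliques V F)"
  proof (rule card_inj_on_le[where f = "\<lambda>v. (c v, d v)"])
    show "inj_on (\<lambda>v. (c v, d v)) V"
      using cE dF assms(2) by (auto simp: inj_on_def) blast
  qed (use c d finite_maximal_cliques[OF assms(1)] in auto)
  then show ?thesis
    by (simp add: card_cartesian_product num_maximal_cliques_def)
qed

lemma factorization_edge_bound:
  assumes "complete_graph_factorization t n G"
  shows "t * n \<le> (\<Sum>i<t. num_maximal_cliques {..<n} (G i)) + (n choose 2)"
proof -
  have sub: "G i \<subseteq> nsets {..<n} 2" if "i < t" for i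
    using assms that unfolding complete_graph_factorization_def by blast
  have fin: "finite (nsets {..<n} 2)"
    by (simp add: finite_imp_finite_nsets)
  have "(\<Sum>i<t. card (G i)) = card (\<Union>i<t. G i)"
  proof (rule card_UN_disjoint[symmetric])
    show "\<forall>i\<in>{..<t}. finite (G i)"
      using sub finite_subset[OF _ fin] by blast
    show "\<forall>i\<in>{..<t}. \<forall>j\<in>{..<t}. i \<noteq> j \<longrightarrow> G i \<inter> G j = {}"
      using assms unfolding complete_graph_factorization_def disjoint_family_on_def by blast
  qed simp
  also have "\<dots> = n choose 2"
    using assms binomial_eq_nsets[of n 2]
    unfolding complete_graph_factorization_def atLeast0LessThan by simp
  finally have edges: "(\<Sum>i<t. card (G i)) = n choose 2" .
  have "n \<le> num_maximal_cliques {..<n} (G i) + card (G i)" if "i < t" for i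
    using card_le_num_maximal_cliques_plus_edges[of "{..<n}" "G i"] sub[OF that]
    by (simp add: Int_absorb2)
  then have "(\<Sum>i<t. n) \<le> (\<Sum>i<t. num_maximal_cliques {..<n} (G i) + card (G i))"
    by (intro sum_mono) auto
  then show ?thesis
    using edges by (simp add: sum.distrib)
qed

text \<open>
  The witness \<open>s\<close> is the smallest number of maximal cliques of a factor. Each of the other \<open>t - 1\<close>
  numbers \<open>x\<close> satisfies \<open>s \<le> x\<close> and \<open>n \<le> s * x\<close>, and \<open>q\<close> stands for a lower bound deduced from this.
\<close>

lemma factorization_product_bound:
  assumes "complete_graph_factorization t n G" "t \<ge> 1"
  obtains s where "\<And>q. (\<And>x. s \<le> x \<Longrightarrow> n \<le> s * x \<Longrightarrow> q \<le> x) \<Longrightarrow>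
    s + (t - 1) * q \<le> (\<Sum>i<t. num_maximal_cliques {..<n} (G i))"
proof -
  define c where "c i = num_maximal_cliques {..<n} (G i)" for i
  have "c ` {..<t} \<noteq> {}"
    using assms(2) by (auto simp: lessThan_empty_iff)
  then have "Min (c ` {..<t}) \<in> c ` {..<t}"
    by (intro Min_in) auto
  then obtain i where i: "i < t" "c i = Min (c ` {..<t})"
    by force
  have min: "c i \<le> c j" if "j < t" for j
    using that i(2) by (auto intro: Min_le)
  have prod: "n \<le> c i * c j" if "j < t" "j \<noteq> i" for j
  proof -
    have "G i \<inter> G j = {}"
      using assms(1) i(1) that
      unfolding complete_graph_factorization_def disjoint_family_on_def by auto
    then show ?thesis
      using card_le_num_maximal_cliques_mult[of "{..<n}" "G i" "G j"] by (simp add: c_def)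
  qed
  have "c i + (t - 1) * q \<le> (\<Sum>j<t. c j)"
    if "\<And>x. c i \<le> x \<Longrightarrow> n \<le> c i * x \<Longrightarrow> q \<le> x" for q
  proof -
    have "(\<Sum>j\<in>{..<t} - {i}. q) \<le> (\<Sum>j\<in>{..<t} - {i}. c j)"
      using that min prod by (intro sum_mono) auto
    then show ?thesis
      using sum.remove[of "{..<t}" i c] i(1) by simp
  qed
  then show ?thesis
    by (rule that[of "c i", unfolded c_def[symmetric]])
qed

lemma f2_edge_lower_bound:
  assumes "t \<ge> 1"
  shows "t * n \<le> f2 t n + (n choose 2)"
  using f2_attained[OF assms, of n] factorization_edge_bound by metis

lemma f2_product_lower_bound:
  assumes "t \<ge> 1"
  obtains s where "\<And>q. (\<And>x. s \<le> x \<Longrightarrow> n \<le> s * x \<Longrightarrow> q \<le> x) \<Longrightarrow> s + (t - 1) * q \<le> f2 t n"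
proof -
  obtain G where "complete_graph_factorization t n G"
    and "f2 t n = (\<Sum>i<t. num_maximal_cliques {..<n} (G i))"
    using f2_attained[OF assms, of n] by blast
  then show ?thesis
    using factorization_product_bound[OF _ assms] that by metis
qed

lemma f2_mono:
  assumes "t \<ge> 1" "m \<le> n"
  shows "f2 t m \<le> f2 t n"
proof -
  obtain G where G: "complete_graph_factorization t n G"
    and eq: "f2 t n = (\<Sum>i<t. num_maximal_cliques {..<n} (G i))"
    using f2_attained[OF assms(1)] by blast
  define H where "H i = G i \<inter> nsets {..<m} 2" for i
  have sub: "nsets {..<m} 2 \<subseteq> nsets {..<n} 2"
    using assms(2) by (intro nsets_mono) auto
  have "disjoint_family_on H {..<t}"
    using G unfolding complete_graph_factorization_def disjoint_family_on_def H_def by blast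
  moreover have "(\<Union>i<t. H i) = nsets {..<m} 2"
    using G sub unfolding complete_graph_factorization_def H_def by blast
  ultimately have "complete_graph_factorization t m H"
    by (simp add: complete_graph_factorization_def)
  then have "f2 t m \<le> (\<Sum>i<t. num_maximal_cliques {..<m} (H i))"
    by (rule f2_le)
  also have "\<dots> \<le> (\<Sum>i<t. num_maximal_cliques {..<n} (G i))"
  proof (rule sum_mono)
    fix i
    have "num_maximal_cliques {..<m} (H i) = num_maximal_cliques {..<m} (G i)"
      unfolding num_maximal_cliques_def H_def by (subst maximal_cliques_cong[of _ _ "G i"]) auto
    also have "\<dots> \<le> num_maximal_cliques {..<n} (G i)"
      by (rule num_maximal_cliques_mono) (use assms(2) in auto)
    finally show "num_maximal_cliques {..<m} (H i) \<le> num_maximal_cliques {..<n} (G i)" .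
  qed
  finally show ?thesis
    by (simp add: eq)
qed

section \<open>Substitution into a design\<close>

text \<open>
  Read \<open>cls i\<close> as mapping a point to its line in the \<open>i\<close>-th parallel class. An optimal factorization of
  \<open>K\<^sub>n\<close> is substituted for the point \<open>0\<close>: the vertices below \<open>n\<close> are sent to the point \<open>0\<close>, and vertex
  \<open>n - 1 + p\<close> is the point \<open>p > 0\<close>. In the \<open>i\<close>-th factor every line not through \<open>0\<close> is one maximal clique, and
  the other points on the line through \<open>0\<close> are adjacent to all vertices below \<open>n\<close>.
\<close>

lemma f2_substitute:
  fixes cls :: "nat \<Rightarrow> nat \<Rightarrow> 'b"
  assumes "t \<ge> 1" "n \<ge> 1"
    and design: "\<And>p q. p \<le> k \<Longrightarrow> q \<le> k \<Longrightarrow> p \<noteq> q \<Longrightarrow> \<exists>!i. i < t \<and> cls i p = cls i q"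
  shows "f2 t (n + k) + t \<le> f2 t n + (\<Sum>i<t. card (cls i ` {..k}))"
proof -
  obtain G where G: "complete_graph_factorization t n G"
    and eq: "f2 t n = (\<Sum>i<t. num_maximal_cliques {..<n} (G i))"
    using f2_attained[OF assms(1)] by blast
  have Gsub: "G i \<subseteq> nsets {..<n} 2" if "i < t" for i
    using G that unfolding complete_graph_factorization_def by blast
  have Gdisj: "G i \<inter> G j = {}" if "i < t" "j < t" "i \<noteq> j" for i j
    using G that unfolding complete_graph_factorization_def disjoint_family_on_def by auto
  define \<pi> where "\<pi> v = (if v < n then 0 else v - n + 1)" for v
  have \<pi>_le: "\<pi> v \<le> k" if "v < n + k" for v
    using that assms(2) by (auto simp: \<pi>_def)
  have \<pi>_eq: "\<pi> u = \<pi> v \<longleftrightarrow> u = v \<or> u < n \<and> v < n" for u v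
    by (auto simp: \<pi>_def)
  have \<pi>_range: "\<pi> ` {..<n + k} = {..k}"
  proof
    show "{..k} \<subseteq> \<pi> ` {..<n + k}"
    proof
      fix p assume "p \<in> {..k}"
      then have "p = \<pi> (n - 1 + p)" "n - 1 + p < n + k"
        using assms(2) by (auto simp: \<pi>_def)
      then show "p \<in> \<pi> ` {..<n + k}" by blast
    qed
  qed (use \<pi>_le in auto)
  define H where "H i = G i \<union>
      {{u, v} | u v. u < n + k \<and> v < n + k \<and> \<pi> u \<noteq> \<pi> v \<and> cls i (\<pi> u) = cls i (\<pi> v)}"
    for i
  have H_iff: "{u, v} \<in> H i \<longleftrightarrow> (if \<pi> u = \<pi> v then {u, v} \<in> G i else cls i (\<pi> u) = cls i (\<pi> v))"
    if "i < t" "u < n + k" "v < n + k" for i u v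
  proof (cases "\<pi> u = \<pi> v")
    case False
    then have "{u, v} \<notin> G i"
      using Gsub[OF that(1)] by (auto simp: \<pi>_eq)
    then show ?thesis
      using False that(2,3) by (auto simp: H_def doubleton_eq_iff)
  qed (auto simp: H_def doubleton_eq_iff)
  have Hsub: "H i \<subseteq> nsets {..<n + k} 2" if "i < t" for i
    using Gsub[OF that] nsets_mono[of "{..<n}" "{..<n + k}" 2] unfolding H_def by auto
  have "disjoint_family_on H {..<t}"
    unfolding disjoint_family_on_def
  proof (intro ballI impI)
    fix i j assume ij: "i \<in> {..<t}" "j \<in> {..<t}" "i \<noteq> j"
    have "e \<notin> H j" if e: "e \<in> H i" for e
    proof -
      have "e \<in> nsets {..<n + k} 2"
        using e ij Hsub by auto
      then obtain u v where uv: "e = {u, v}" "u < n + k" "v < n + k"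
        by (auto elim!: nsets2_E)
      show ?thesis
        using e ij Gdisj[of i j] design[of "\<pi> u" "\<pi> v"] \<pi>_le[OF uv(2)] \<pi>_le[OF uv(3)]
        unfolding uv(1) by (auto simp: H_iff uv split: if_splits)
    qed
    then show "H i \<inter> H j = {}" by auto
  qed
  moreover have "(\<Union>i<t. H i) = nsets {..<n + k} 2"
  proof
    show "nsets {..<n + k} 2 \<subseteq> (\<Union>i<t. H i)"
    proof
      fix e assume "e \<in> nsets {..<n + k} 2"
      then obtain u v where uv: "e = {u, v}" "u < n + k" "v < n + k" "u \<noteq> v"
        by (auto elim!: nsets2_E)
      show "e \<in> (\<Union>i<t. H i)"
      proof (cases "\<pi> u = \<pi> v")
        case True
        then have "e \<in> nsets {..<n} 2"
          using uv by (auto simp: \<pi>_eq)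
        then have "e \<in> (\<Union>i<t. G i)"
          using G by (simp add: complete_graph_factorization_def)
        then show ?thesis
          by (auto simp: H_def)
      next
        case False
        then obtain i where "i < t" "cls i (\<pi> u) = cls i (\<pi> v)"
          using design[of "\<pi> u" "\<pi> v"] \<pi>_le uv by blast
        then show ?thesis
          using False uv by (auto simp: H_iff)
      qed
    qed
  qed (use Hsub in auto)
  ultimately have "complete_graph_factorization t (n + k) H"
    by (simp add: complete_graph_factorization_def)
  then have "f2 t (n + k) \<le> (\<Sum>i<t. num_maximal_cliques {..<n + k} (H i))"
    by (rule f2_le)
  moreover have "num_maximal_cliques {..<n + k} (H i) + 1
      \<le> num_maximal_cliques {..<n} (G i) + card (cls i ` {..k})" if i: "i < t" for i
  proof -
    define line where "line x = {v \<in> {..<n + k}. cls i (\<pi> v) = x}" for x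
    let ?X = "cls i ` {..k}" and ?x0 = "cls i 0"
    have X: "(\<lambda>v. cls i (\<pi> v)) ` {..<n + k} = ?X"
      using \<pi>_range by (metis image_image)
    have "num_maximal_cliques {..<n + k} (H i) \<le> (\<Sum>x\<in>?X. num_maximal_cliques (line x) (H i))"
      unfolding X[symmetric] line_def
      by (rule num_maximal_cliques_fibres) (use assms(2) i in \<open>auto simp: H_iff split: if_splits\<close>)
    also have "\<dots> = num_maximal_cliques (line ?x0) (H i)
        + (\<Sum>x\<in>?X - {?x0}. num_maximal_cliques (line x) (H i))"
      by (rule sum.remove) auto
    also have "(\<Sum>x\<in>?X - {?x0}. num_maximal_cliques (line x) (H i)) = (\<Sum>x\<in>?X - {?x0}. 1)"
    proof (rule sum.cong)
      fix x assume "x \<in> ?X - {?x0}"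
      then have "clique (line x) (H i)"
        using i by (auto simp: clique_def line_def H_iff \<pi>_eq) (auto simp: \<pi>_def)
      then show "num_maximal_cliques (line x) (H i) = 1"
        by (rule num_maximal_cliques_clique)
    qed simp
    also have "\<dots> = card ?X - 1"
      by simp
    also have "num_maximal_cliques (line ?x0) (H i) \<le> num_maximal_cliques {..<n} (G i)"
    proof -
      have "line ?x0 = {..<n} \<union> (line ?x0 - {..<n})"
        by (auto simp: line_def \<pi>_def)
      moreover have "num_maximal_cliques ({..<n} \<union> (line ?x0 - {..<n})) (H i)
          \<le> num_maximal_cliques {..<n} (H i)"
      proof (rule num_maximal_cliques_join)
        fix l x assume l: "l \<in> line ?x0 - {..<n}" and x: "x \<in> {..<n} \<union> (line ?x0 - {..<n})"
          and "l \<noteq> x"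
        have "x < n + k" "cls i (\<pi> x) = ?x0"
          using x by (auto simp: line_def \<pi>_def)
        moreover have "\<pi> l \<noteq> \<pi> x"
          using l \<open>l \<noteq> x\<close> by (simp add: \<pi>_eq)
        ultimately show "{l, x} \<in> H i"
          using l i by (simp add: H_iff line_def)
      qed (auto simp: line_def)
      moreover have "maximal_cliques {..<n} (H i) = maximal_cliques {..<n} (G i)"
        by (rule maximal_cliques_cong) (use i in \<open>auto simp: H_iff \<pi>_eq\<close>)
      ultimately show ?thesis
        by (simp add: num_maximal_cliques_def)
    qed
    finally have "num_maximal_cliques {..<n + k} (H i)
        \<le> num_maximal_cliques {..<n} (G i) + (card ?X - 1)"
      by simp
    moreover have "card ?X > 0"
      by (simp add: card_gt_0_iff)
    ultimately show ?thesis by linarith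
  qed
  then have "(\<Sum>i<t. num_maximal_cliques {..<n + k} (H i) + 1)
      \<le> (\<Sum>i<t. num_maximal_cliques {..<n} (G i) + card (cls i ` {..k}))"
    by (intro sum_mono) auto
  ultimately show ?thesis
    unfolding eq sum.distrib by simp
qed

text \<open>
  The lines of the affine plane of order 3. The coordinates \<open>x\<close>, \<open>y\<close> of point \<open>p\<close> are read off two
  lists, and the four directions are given by the linear forms \<open>x\<close>, \<open>y\<close>, \<open>x + y\<close>, \<open>x + 2 y\<close>. The points are ordered so that
  initial segments of sizes \<open>2\<close>, \<open>3\<close>, \<open>4\<close>, \<open>6\<close> are two points, a triangle, a quadrangle and two parallel
  lines, which meet few lines.
\<close>

definition plane_line :: "nat \<Rightarrow> nat \<Rightarrow> nat" where
  "plane_line i p =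
    (let x = [0, 0, 1, 1, 0, 1, 2, 2, 2] ! p; y = [0, 1, 0, 1, 2, 2, 0, 1, 2] ! p
     in [x, y, (x + y) mod 3, (x + 2 * y) mod 3] ! i)"

lemma plane_line_unique:
  assumes "p \<le> 8" "q \<le> 8" "p \<noteq> q"
  shows "\<exists>!i. i < 4 \<and> plane_line i p = plane_line i q"
proof -
  have "\<forall>p\<in>set [0..<9]. \<forall>q\<in>set [0..<9]. p \<noteq> q \<longrightarrow>
      length (filter (\<lambda>i. plane_line i p = plane_line i q) [0..<4]) = 1"
    by code_simp
  then have "length (filter (\<lambda>i. plane_line i p = plane_line i q) [0..<4]) = 1"
    using assms by simp
  then obtain i where "filter (\<lambda>i. plane_line i p = plane_line i q) [0..<4] = [i]"
    by (auto simp: length_Suc_conv)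
  then have "set (filter (\<lambda>i. plane_line i p = plane_line i q) [0..<4]) = {i}"
    by simp
  then have "i' < 4 \<and> plane_line i' p = plane_line i' q \<longleftrightarrow> i' = i" for i'
    by (auto simp: set_eq_iff)
  then show ?thesis
    by simp
qed

lemma f2_plane_substitute:
  assumes "n \<ge> 1" "k \<le> 8"
  shows "f2 4 (n + k) + 4 \<le> f2 4 n + (\<Sum>i<4. card (plane_line i ` {..k}))"
  by (rule f2_substitute) (use assms plane_line_unique in auto)

section \<open>Four factors\<close>

lemma f2_4_add_8:
  assumes "n \<ge> 1"
  shows "f2 4 (n + 8) \<le> f2 4 n + 8"
proof -
  have "(\<Sum>i<4. card (plane_line i ` {..8})) = 12"
    by code_simp
  then show ?thesis
    using f2_plane_substitute[OF assms, of 8] by simp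
qed

text \<open>Substituting a single vertex leaves the initial segment of the plane itself.\<close>

lemma f2_4_small_upper:
  "f2 4 1 \<le> 4" "f2 4 2 \<le> 7" "f2 4 3 \<le> 9" "f2 4 4 \<le> 10" "f2 4 6 \<le> 11" "f2 4 9 \<le> 12"
proof -
  show 1: "f2 4 1 \<le> 4"
  proof -
    obtain G where "complete_graph_factorization 4 1 G"
      using complete_graph_factorization_exists[of 4 1] by auto
    then have "f2 4 1 \<le> (\<Sum>i<4. num_maximal_cliques {..<1} (G i))"
      by (rule f2_le)
    also have "\<dots> = (\<Sum>i<4::nat. 1)"
      by (intro sum.cong num_maximal_cliques_clique) (auto simp: clique_def)
    finally show ?thesis by simp
  qed
  have sub: "f2 4 (k + 1) \<le> (\<Sum>i<4. card (plane_line i ` {..k}))" if "k \<le> 8" for k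
    using f2_plane_substitute[of 1 k] that 1 by (simp add: add.commute)
  have cards: "(\<Sum>i<4. card (plane_line i ` {..1})) = 7"
    "(\<Sum>i<4. card (plane_line i ` {..2})) = 9"
    "(\<Sum>i<4. card (plane_line i ` {..3})) = 10"
    "(\<Sum>i<4. card (plane_line i ` {..5})) = 11"
    "(\<Sum>i<4. card (plane_line i ` {..8})) = 12"
    by code_simp+
  show "f2 4 2 \<le> 7" "f2 4 3 \<le> 9" "f2 4 4 \<le> 10" "f2 4 6 \<le> 11" "f2 4 9 \<le> 12"
    using sub[of 1, unfolded one_add_one] sub[of 2] sub[of 3] sub[of 5] sub[of 8]
    unfolding cards by simp_all
qed

lemma f2_4_small_lower:
  "4 \<le> f2 4 1" "7 \<le> f2 4 2" "9 \<le> f2 4 3" "10 \<le> f2 4 4" "11 \<le> f2 4 5" "12 \<le> f2 4 7"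
  "15 \<le> f2 4 10"
proof -
  show "4 \<le> f2 4 1" "7 \<le> f2 4 2" "9 \<le> f2 4 3" "10 \<le> f2 4 4"
    using f2_edge_lower_bound[of 4 1] f2_edge_lower_bound[of 4 2]
      f2_edge_lower_bound[of 4 3] f2_edge_lower_bound[of 4 4]
    by (simp_all add: choose_two)
next
  \<comment> \<open>Below, \<open>s\<close> is the least number of maximal cliques of a factor; the other three numbers are
    at least \<open>s\<close> and at least \<open>n\<close> divided by \<open>s\<close>, rounded up.\<close>
  obtain s where s: "\<And>q. (\<And>x. s \<le> x \<Longrightarrow> 5 \<le> s * x \<Longrightarrow> q \<le> x) \<Longrightarrow> s + (4 - 1) * q \<le> f2 4 5"
    using f2_product_lower_bound[of 4 5] by auto
  consider "s = 0" | "s = 1" | "s = 2" | "s \<ge> 3" by linarith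
  then show "11 \<le> f2 4 5"
    by cases (use s[of 5] s[of 3] in auto)
next
  obtain s where s: "\<And>q. (\<And>x. s \<le> x \<Longrightarrow> 7 \<le> s * x \<Longrightarrow> q \<le> x) \<Longrightarrow> s + (4 - 1) * q \<le> f2 4 7"
    using f2_product_lower_bound[of 4 7] by auto
  consider "s = 0" | "s = 1" | "s = 2" | "s \<ge> 3" by linarith
  then show "12 \<le> f2 4 7"
    by cases (use s[of 7] s[of 4] s[of 3] in auto)
next
  obtain s where s: "\<And>q. (\<And>x. s \<le> x \<Longrightarrow> 10 \<le> s * x \<Longrightarrow> q \<le> x) \<Longrightarrow> s + (4 - 1) * q \<le> f2 4 10"
    using f2_product_lower_bound[of 4 10] by auto
  consider "s = 0" | "s = 1" | "s = 2" | "s = 3" | "s \<ge> 4" by linarith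
  then show "15 \<le> f2 4 10"
    by cases (use s[of 10] s[of 5] s[of 4] in auto)
qed

definition f2_4_bound :: "nat \<Rightarrow> nat" where
  "f2_4_bound n = (if n mod 8 = 1 then n + 3
                   else if n mod 8 = 0 then n + 4
                   else if n mod 8 \<in> {2, 6, 7} then n + 5
                   else n + 6)"

lemma f2_4_upper: "n \<ge> 1 \<Longrightarrow> f2 4 n \<le> f2_4_bound n"
proof (induction n rule: less_induct)
  case (less n)
  show ?case
  proof (cases "n \<le> 8")
    case True
    then consider "n = 1" | "n = 2" | "n = 3" | "n = 4" | "n = 5" | "n = 6" | "n = 7" | "n = 8"
      using less.prems by linarith
    then show ?thesis
      using f2_4_small_upper f2_mono[of 4 5 6] f2_mono[of 4 7 9] f2_mono[of 4 8 9]
      by cases (auto simp: f2_4_bound_def)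
  next
    case False
    define m where "m = n - 8"
    have m: "n = m + 8" "m \<ge> 1" "m < n"
      using False by (auto simp: m_def)
    have "f2 4 n \<le> f2 4 m + 8"
      unfolding m(1) by (rule f2_4_add_8) (rule m(2))
    also have "\<dots> \<le> f2_4_bound m + 8"
      using less.IH[OF m(3,2)] by simp
    also have "\<dots> = f2_4_bound n"
      unfolding m(1) f2_4_bound_def by simp
    finally show ?thesis .
  qed
qed

lemma f2_4_lower:
  assumes "n \<ge> 1" "n \<le> 10"
  shows "f2_4_bound n \<le> f2 4 n"
proof -
  have "n = 1 \<or> n = 2 \<or> n = 3 \<or> n = 4 \<or> n = 5 \<or> n = 6 \<or> n = 7 \<or> n = 8 \<or> n = 9 \<or> n = 10"
    using assms by presburger
  then show ?thesis
    using f2_4_small_lower f2_mono[of 4 5 6] f2_mono[of 4 7 8] f2_mono[of 4 7 9]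
    by (elim disjE) (simp_all add: f2_4_bound_def)
qed

theorem theorem25:
  fixes n :: nat
  assumes "n \<ge> 1"
  shows "let b = (if n mod 8 = 1 then n + 3
                  else if n mod 8 = 0 then n + 4
                  else if n mod 8 \<in> {2, 6, 7} then n + 5
                  else n + 6)
         in f2 4 n \<le> b \<and> (n \<le> 10 \<longrightarrow> f2 4 n = b)"
  unfolding f2_4_bound_def[symmetric] Let_def
  using f2_4_upper[OF assms] f2_4_lower[OF assms] by (auto intro: antisym)

end
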